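(* Let $\alpha,\beta>-1$, $0<k<\beta+1$, $\ell\in\mathbb N$, and let $\lambda=\lambda_j(w)$ for some $w\in\mathbb N_0$ and some $0\le j\le\ell$. Then $$\dim\{P\in V(\lambda):\deg P\le w\}=\operatorname{card}\{w':0\le w'\le w,\ \lambda=\lambda_{j'}(w')\text{ for some }0\le j'\le\ell\}.$$ In particular, $$\dim V(\lambda)=\operatorname{card}\{(w,j):\lambda=\lambda_j(w)\},$$ where $(w,j)$ ranges over $\mathbb N_0\times\{0,\dots,\ell\}$.
   Context: Matrices are $(\ell+1)\times(\ell+1)$ with rows and columns indexed by $0,\dots,\ell$; $E_{ij}$ is the matrix with $(i,j)$ entry $1$ and all other entries $0$. $\mathbb N=\{1,2,\dots\}$, $\mathbb N_0=\mathbb N\cup\{0\}$. For $w\in\mathbb N_0$ and $0\le j\le\ell$, $$\lambda_j(w)=-w(w+\alpha+\beta+\ell+j+1)-j(\alpha+\beta-k+1+j).$$ The operator $D$, acting on $\mathbb C^{\ell+1}$-valued functions (column vectors), is $$D=u(1-u)\frac{d^2}{du^2}+(C-uU)\frac{d}{du}-V,$$ $$C=\sum_{i=0}^\ell(\beta+1+2i)E_{ii}+\sum_{i=1}^\ell iE_{i,i-1},\qquad U=\sum_{i=0}^\ell(\alpha+\beta+\ell+i+2)E_{ii},$$ $$V=\sum_{i=0}^\ell i(\alpha+\beta+i-k+1)E_{ii}-\sum_{i=0}^{\ell-1}(\ell-i)(i+\beta-k+1)E_{i,i+1}.$$ $V(\lambda)$ denotes the complex vector space of all $\mathbb C^{\ell+1}$-valued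 polynomials $P$ in $u$ such that $DP=\lambda P$ (the zero polynomial is included in every degree bound). *)

theory Defs
  imports Complex_Main "HOL-Library.Function_Algebras" "HOL-Computational_Algebra.Polynomial"
begin

text \<open>
  A matrix with rows and columns \<open>0, \<dots>, l\<close> is the function \<open>(row, column) \<mapsto> entry\<close>,
  vanishing outside the index range.
  A \<open>\<complex>\<^sup>l\<^sup>+\<^sup>1\<close>-valued polynomial in \<open>u\<close> is the family
  of its components: a function \<open>nat \<Rightarrow> complex poly\<close> vanishing at all indices above \<open>l\<close>.
\<close>

type_synonym vpoly = "nat \<Rightarrow> complex poly"

definition vpolys :: "nat \<Rightarrow> vpoly set" where
  "vpolys l = {P. \<forall>i>l. P i = 0}"

text \<open>The zero polynomial gets degree \<open>0\<close>, hence satisfies every bound \<open>vdegree l P \<le> w\<close>.\<close>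

definition vdegree :: "nat \<Rightarrow> vpoly \<Rightarrow> nat" where
  "vdegree l P = Max ((\<lambda>i. degree (P i)) ` {..l})"

definition vscale :: "complex \<Rightarrow> vpoly \<Rightarrow> vpoly" where
  "vscale c P = (\<lambda>i. smult c (P i))"

interpretation vpoly: vector_space vscale
  by unfold_locales (auto simp: vscale_def fun_eq_iff smult_add_left smult_add_right)

definition matE :: "nat \<Rightarrow> nat \<Rightarrow> nat \<Rightarrow> nat \<Rightarrow> real" where
  "matE i j = (\<lambda>r s. if r = i \<and> s = j then 1 else 0)"

definition matC :: "real \<Rightarrow> nat \<Rightarrow> nat \<Rightarrow> nat \<Rightarrow> real" where
  "matC \<beta> l = (\<lambda>r s. (\<Sum>i\<le>l. (\<beta> + 1 + 2 * real i) * matE i i r s)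
                   + (\<Sum>i=1..l. real i * matE i (i - 1) r s))"

definition matU :: "real \<Rightarrow> real \<Rightarrow> nat \<Rightarrow> nat \<Rightarrow> nat \<Rightarrow> real" where
  "matU \<alpha> \<beta> l = (\<lambda>r s. \<Sum>i\<le>l. (\<alpha> + \<beta> + real l + real i + 2) * matE i i r s)"

definition matV :: "real \<Rightarrow> real \<Rightarrow> real \<Rightarrow> nat \<Rightarrow> nat \<Rightarrow> nat \<Rightarrow> real" where
  "matV \<alpha> \<beta> k l = (\<lambda>r s. (\<Sum>i\<le>l. real i * (\<alpha> + \<beta> + real i - k + 1) * matE i i r s)
                   - (\<Sum>i<l. (real l - real i) * (real i + \<beta> - k + 1) * matE i (i + 1) r s))"

definition matvec :: "nat \<Rightarrow> (nat \<Rightarrow> nat \<Rightarrow> real) \<Rightarrow> vpoly \<Rightarrow> vpoly" where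
  "matvec l A P = (\<lambda>r. \<Sum>s\<le>l. smult (complex_of_real (A r s)) (P s))"

text \<open>Here \<open>[:0, 1:]\<close> is the variable \<open>u\<close>, so that \<open>[:0, 1:] * (1 - [:0, 1:])\<close> is \<open>u(1 - u)\<close>.\<close>

definition opD :: "real \<Rightarrow> real \<Rightarrow> real \<Rightarrow> nat \<Rightarrow> vpoly \<Rightarrow> vpoly" where
  "opD \<alpha> \<beta> k l P = (let P' = (\<lambda>i. pderiv (P i)); P'' = (\<lambda>i. pderiv (P' i)) in
     (\<lambda>r. [:0, 1:] * (1 - [:0, 1:]) * P'' r
        + (matvec l (matC \<beta> l) P' r - [:0, 1:] * matvec l (matU \<alpha> \<beta> l) P' r)
        - matvec l (matV \<alpha> \<beta> k l) P r))"

definition eigval :: "real \<Rightarrow> real \<Rightarrow> real \<Rightarrow> nat \<Rightarrow> nat \<Rightarrow> nat \<Rightarrow> real" where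
  "eigval \<alpha> \<beta> k l j w = - real w * (real w + \<alpha> + \<beta> + real l + real j + 1)
                         - real j * (\<alpha> + \<beta> - k + 1 + real j)"

definition eigspace :: "real \<Rightarrow> real \<Rightarrow> real \<Rightarrow> nat \<Rightarrow> complex \<Rightarrow> vpoly set" where
  "eigspace \<alpha> \<beta> k l lam = {P \<in> vpolys l. opD \<alpha> \<beta> k l P = vscale lam P}"

text \<open>
  The library's \<^term>\<open>vpoly.dim S\<close> is the dimension of the span of \<^term>\<open>S\<close>, and it is \<open>0\<close> in
  infinite dimension, as is \<^term>\<open>card\<close> of an infinite set. The facts below exclude these
  degenerate readings: the sets whose dimension is taken are subspaces, and the index set counted
  is finite (and nonempty when \<open>lam\<close> is an eigenvalue \<open>eigval \<alpha> \<beta> k l j w\<close>).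
\<close>

lemma vdegree_le_iff: "vdegree l P \<le> w \<longleftrightarrow> (\<forall>i\<le>l. degree (P i) \<le> w)"
  by (auto simp: vdegree_def)

lemma matvec_add: "matvec l A (P + Q) = matvec l A P + matvec l A Q"
  by (simp add: matvec_def fun_eq_iff smult_add_right sum.distrib)

lemma matvec_scale: "matvec l A (vscale c P) = vscale c (matvec l A P)"
proof -
  have "smult a (\<Sum>s\<le>l. f s) = (\<Sum>s\<le>l. smult a (f s))" for a and f :: vpoly
    by (induction l) (simp_all add: smult_add_right)
  then show ?thesis
    by (simp add: matvec_def vscale_def fun_eq_iff mult.commute)
qed

lemma opD_add: "opD \<alpha> \<beta> k l (P + Q) = opD \<alpha> \<beta> k l P + opD \<alpha> \<beta> k l Q"
proof -
  have 1: "(\<lambda>i. pderiv ((P + Q) i)) = (\<lambda>i. pderiv (P i)) + (\<lambda>i. pderiv (Q i))" for P Q :: vpoly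
    by (simp add: fun_eq_iff pderiv_add)
  show ?thesis
    by (simp only: opD_def Let_def 1 matvec_add) (simp add: fun_eq_iff pderiv_add algebra_simps)
qed

lemma opD_scale: "opD \<alpha> \<beta> k l (vscale c P) = vscale c (opD \<alpha> \<beta> k l P)"
proof -
  have 1: "(\<lambda>i. pderiv (vscale c P i)) = vscale c (\<lambda>i. pderiv (P i))" for P :: vpoly
    by (simp add: fun_eq_iff vscale_def pderiv_smult)
  show ?thesis
    by (simp only: opD_def Let_def 1 matvec_scale)
      (simp add: fun_eq_iff vscale_def pderiv_smult smult_add_right smult_diff_right algebra_simps)
qed

lemma subspace_eigspace: "vpoly.subspace (eigspace \<alpha> \<beta> k l lam)"
proof -
  have "opD \<alpha> \<beta> k l 0 = 0"
    using opD_scale[of \<alpha> \<beta> k l 0 0] by (simp add: vscale_def zero_fun_def)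
  then show ?thesis
    unfolding vpoly.subspace_def eigspace_def
    by (auto simp: vpolys_def opD_add opD_scale vpoly.scale_right_distrib mult.commute)
      (auto simp: vscale_def)
qed

lemma subspace_eigspace_degree:
  "vpoly.subspace {P \<in> eigspace \<alpha> \<beta> k l lam. vdegree l P \<le> w}"
  using subspace_eigspace[of \<alpha> \<beta> k l lam]
  by (auto simp: vpoly.subspace_def vdegree_le_iff degree_add_le vscale_def
      intro: order_trans[OF degree_smult_le])

lemma finite_eigval_eq:
  "finite {(w, j). j \<le> l \<and> lam = eigval \<alpha> \<beta> k l j w}"
proof -
  have "finite {w. lam = eigval \<alpha> \<beta> k l j w}" for j
  proof -
    let ?p = "[:lam + real j * (\<alpha> + \<beta> - k + 1 + real j), \<alpha> + \<beta> + real l + real j + 1, 1:]"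
    have "finite (real -` {x. poly ?p x = 0})"
      by (intro finite_vimageI poly_roots_finite) (auto simp: inj_def)
    moreover have "{w. lam = eigval \<alpha> \<beta> k l j w} \<subseteq> real -` {x. poly ?p x = 0}"
      by (auto simp: eigval_def algebra_simps)
    ultimately show ?thesis by (rule finite_subset[rotated])
  qed
  then have "finite (\<Union>j\<in>{..l}. {w. lam = eigval \<alpha> \<beta> k l j w} \<times> {j})"
    by auto
  then show ?thesis
    by (rule finite_subset[rotated]) auto
qed

end

theory Submission
  imports Defs
begin

text \<open>
Write \<open>p n i\<close> for the coefficient of \<open>u\<^sup>n\<close> in the \<open>i\<close>-th component of a vector polynomial, and order
the pairs \<open>(n, i)\<close> lexicographically, i.e. by their \<^emph>\<open>position\<close> \<open>n * (l + 1) + i\<close>. The operator \<open>D\<close>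
expresses the entry at \<open>(n, i)\<close> through the entries at \<open>(n, i)\<close>, \<open>(n, i + 1)\<close>, \<open>(n + 1, i - 1)\<close> and
\<open>(n + 1, i)\<close>, none of which has a smaller position. So \<open>D\<close> is triangular, with diagonal entry
\<open>\<lambda>\<^sub>i(n)\<close> at \<open>(n, i)\<close>. Hence the last nonzero entry of a solution of \<open>D P = \<lambda> P\<close> sits at some
\<open>(n, i)\<close> with \<open>\<lambda>\<^sub>i(n) = \<lambda>\<close>, and the dimension of the space of solutions of degree at most \<open>w\<close> is
at most the number of such pairs with \<open>n \<le> w\<close>. Equality holds once each such pair is the place
of the last nonzero entry of some solution.

This is the heart of the matter, because a triangular operator with repeated diagonal entries
may have nontrivial Jordan blocks. They are excluded here by a second differential operator \<open>E\<close>,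
of second order, which is triangular in the same sense and commutes with \<open>D\<close>. Put \<open>t = \<alpha> + \<beta> - k + 1\<close>.
The diagonal entries of \<open>D\<close> and \<open>E\<close> at \<open>(n, i)\<close> are, up to an additive constant, the second and the
third elementary symmetric function of the three numbers \<open>i\<close>, \<open>n + l + k\<close> and \<open>- (n + i + t)\<close>, whose
sum does not depend on \<open>(n, i)\<close>. So together they determine this triple up to order, and the
inequalities between its members then determine \<open>(n, i)\<close> (\<open>diagD_diagE_inj\<close>). Now start
with the unit vector at \<open>(w, j)\<close> and, for every earlier position \<open>(n, i)\<close> in decreasing order,
apply whichever of \<open>D - d\<close>, \<open>E - e\<close> has a diagonal entry that vanishes at \<open>(n, i)\<close> and not at \<open>(w, j)\<close>.
Each step moves the defect \<open>(D - \<lambda>\<^sub>j(w)) P\<close> down by one position and keeps the entry at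
\<open>(w, j)\<close> nonzero; in the end the defect is zero (\<open>triangular_op_eigenvector\<close>).

Finally \<open>\<lambda>\<^sub>i(n) = \<lambda>\<^sub>j(n)\<close> forces \<open>i = j\<close>, so counting the pairs \<open>(n, i)\<close> amounts to counting the
degrees \<open>n\<close>; and as only finitely many pairs occur, the whole solution space has bounded degree.
\<close>

section \<open>Commuting triangular operators\<close>

definition vanish_from :: "nat \<Rightarrow> nat \<Rightarrow> (nat \<Rightarrow> nat \<Rightarrow> 'a::zero) \<Rightarrow> bool" where
  "vanish_from l N p \<longleftrightarrow> (\<forall>n i. i \<le> l \<longrightarrow> N \<le> n * Suc l + i \<longrightarrow> p n i = 0)"

lemma position_div: "i \<le> l \<Longrightarrow> (n * Suc l + i) div Suc l = n" for n l i :: nat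
  by (simp add: div_mult_self3 del: mult_Suc_right)

lemma position_eq_iff:
  "i \<le> l \<Longrightarrow> j \<le> l \<Longrightarrow> n * Suc l + i = w * Suc l + j \<longleftrightarrow> n = w \<and> i = j" for n l w i j :: nat
  by (metis add_left_cancel position_div)

lemma position_exists: "\<exists>n i. i \<le> l \<and> N = n * Suc l + i" for N :: nat
  by (rule exI[of _ "N div Suc l"], rule exI[of _ "N mod Suc l"])
    (metis div_mult_mod_eq less_Suc_eq_le mod_less_divisor zero_less_Suc)

text \<open>
Arrays are defined on all pairs of natural numbers, but only the entries with second index at most \<open>l\<close>
matter: triangularity is required of these entries alone, under a hypothesis on these entries alone.
The first conjunct is linearity in the only form in which it is used.
\<close>

definition triangular_op ::
  "nat \<Rightarrow> ((nat \<Rightarrow> nat \<Rightarrow> 'a::idom) \<Rightarrow> nat \<Rightarrow> nat \<Rightarrow> 'a) \<Rightarrow> (nat \<Rightarrow> nat \<Rightarrow> 'a) \<Rightarrow> bool" where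
  "triangular_op l T d \<longleftrightarrow>
     (\<forall>p q c n i. T (\<lambda>a b. p a b - c * q a b) n i = T p n i - c * T q n i) \<and>
     (\<forall>p n i. i \<le> l \<longrightarrow> vanish_from l (Suc (n * Suc l + i)) p \<longrightarrow> T p n i = d n i * p n i)"

lemma triangular_op_linear:
  "triangular_op l T d \<Longrightarrow> T (\<lambda>a b. p a b - c * q a b) n i = T p n i - c * T q n i"
  unfolding triangular_op_def by blast

lemma triangular_op_diagonal:
  assumes "triangular_op l T d" "vanish_from l (Suc N) p" "i \<le> l" "N \<le> n * Suc l + i"
  shows "T p n i = d n i * p n i"
proof -
  have "vanish_from l (Suc (n * Suc l + i)) p"
    using assms(2,4) unfolding vanish_from_def by (meson Suc_le_mono le_trans)
  then show ?thesis using assms(1,3) unfolding triangular_op_def by blast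
qed

abbreviation shift_op where
  "shift_op T c p \<equiv> (\<lambda>a b. T p a b - c * p a b)"

text \<open>
Only the entry at \<open>(n, i)\<close> itself can survive in \<open>T p\<close> from this position on, and the shift cancels it.
\<close>

lemma vanish_from_shift_op:
  assumes T: "triangular_op l T d" and p: "vanish_from l (Suc (n * Suc l + i)) p" and i: "i \<le> l"
  shows "vanish_from l (n * Suc l + i) (shift_op T (d n i) p)"
  unfolding vanish_from_def
proof (intro allI impI)
  fix a b assume b: "b \<le> l" and le: "n * Suc l + i \<le> a * Suc l + b"
  have Tp: "T p a b = d a b * p a b" by (rule triangular_op_diagonal[OF T p b le])
  show "T p a b - d n i * p a b = 0"
  proof (cases "n * Suc l + i = a * Suc l + b")
    case True
    then have "n = a" "i = b" using position_eq_iff[OF i b] by blast+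
    then show ?thesis using Tp by simp
  next
    case False
    then have "p a b = 0" using p b le unfolding vanish_from_def by simp
    then show ?thesis using Tp by simp
  qed
qed

lemma shift_op_commute:
  assumes T: "triangular_op l T d" and S: "triangular_op l S e" and comm: "S (T p) = T (S p)"
  shows "shift_op S c (shift_op T a p) = shift_op T a (shift_op S c p)"
  by (intro ext) (simp add: triangular_op_linear[OF T] triangular_op_linear[OF S] comm algebra_simps)

text \<open>
Descending induction on a position \<open>N\<close>, up to which both defects \<open>T p - d w j * p\<close> and \<open>S p - e w j * p\<close>
have been reduced. Both defects have to be carried along, because either operator may be
needed to pass the next position \<open>(n, i)\<close>: by separation at least one of \<open>T - d n i\<close>,
\<open>S - e n i\<close> multiplies the entry at \<open>(w, j)\<close> by a nonzero number. Since it commutes with both defect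
operators, it pushes both defects below \<open>(n, i)\<close>.
\<close>

lemma triangular_op_eigenvector:
  fixes T S :: "(nat \<Rightarrow> nat \<Rightarrow> 'a::idom) \<Rightarrow> nat \<Rightarrow> nat \<Rightarrow> 'a"
  assumes T: "triangular_op l T d" and S: "triangular_op l S e"
    and comm: "\<And>p. S (T p) = T (S p)"
    and sep: "\<And>n i. i \<le> l \<Longrightarrow> d n i = d w j \<Longrightarrow> e n i = e w j \<Longrightarrow> n = w \<and> i = j"
    and j: "j \<le> l"
  shows "\<exists>p. vanish_from l (Suc (w * Suc l + j)) p \<and> p w j \<noteq> 0 \<and>
             (\<forall>n. \<forall>i\<le>l. T p n i = d w j * p n i)"
proof -
  let ?M = "w * Suc l + j"
  let ?good = "\<lambda>N p. vanish_from l (Suc ?M) p \<and> p w j \<noteq> 0 \<and>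
      vanish_from l N (shift_op T (d w j) p) \<and> vanish_from l N (shift_op S (e w j) p)"
  have "\<exists>p. ?good 0 p"
  proof (rule inc_induct[of 0 ?M])
    let ?p = "\<lambda>n i. if n = w \<and> i = j then 1 else 0 :: 'a"
    have p: "vanish_from l (Suc ?M) ?p" by (auto simp: vanish_from_def)
    then have "?good ?M ?p"
      using vanish_from_shift_op[OF T p j] vanish_from_shift_op[OF S p j] by simp
    then show "\<exists>p. ?good ?M p" by blast
  next
    fix N assume N: "N < ?M" and "\<exists>p. ?good (Suc N) p"
    then obtain p where p: "vanish_from l (Suc ?M) p" and pj: "p w j \<noteq> 0"
      and Tp: "vanish_from l (Suc N) (shift_op T (d w j) p)"
      and Sp: "vanish_from l (Suc N) (shift_op S (e w j) p)" by blast
    obtain n i where i: "i \<le> l" and Nni: "N = n * Suc l + i" using position_exists by blast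
    have step: "\<exists>p. ?good N p"
      if X: "triangular_op l X f" and ne: "f n i \<noteq> f w j"
        and TX: "\<And>p. T (X p) = X (T p)" and SX: "\<And>p. S (X p) = X (S p)" for X f
    proof -
      let ?q = "shift_op X (f n i) p"
      have Xp: "X p a b = f a b * p a b" if "b \<le> l" "?M \<le> a * Suc l + b" for a b
        using triangular_op_diagonal[OF X p that] .
      have "vanish_from l (Suc ?M) ?q"
        using p Xp unfolding vanish_from_def by simp
      moreover have "?q w j \<noteq> 0"
        using Xp[OF j] pj ne by (simp add: left_diff_distrib[symmetric])
      moreover have "vanish_from l N (shift_op T (d w j) ?q)"
        unfolding shift_op_commute[OF X T TX] Nni
        by (rule vanish_from_shift_op[OF X Tp[unfolded Nni] i])
      moreover have "vanish_from l N (shift_op S (e w j) ?q)"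
        unfolding shift_op_commute[OF X S SX] Nni
        by (rule vanish_from_shift_op[OF X Sp[unfolded Nni] i])
      ultimately show ?thesis by blast
    qed
    consider "d n i \<noteq> d w j" | "e n i \<noteq> e w j"
      using sep[OF i] N Nni by blast
    then show "\<exists>p. ?good N p"
    proof cases
      case 1
      show ?thesis by (rule step[OF T 1 refl comm])
    next
      case 2
      show ?thesis by (rule step[OF S 2 comm[symmetric] refl])
    qed
  qed simp
  then show ?thesis by (auto simp: vanish_from_def)
qed

section \<open>Two commuting operators on coefficient arrays\<close>

text \<open>
With \<open>g = \<beta> - k + 1\<close> and \<open>t = \<alpha> + \<beta> - k + 1\<close> the first operator is \<open>D\<close> on coefficients. In the
terms with \<open>i - 1\<close> the truncation at \<open>i = 0\<close> is harmless because of the factor \<open>i\<close>, and the factor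
\<open>l - i\<close> makes the entries with second index above \<open>l\<close> irrelevant for those up to \<open>l\<close>.
\<close>

definition coeffD :: "'a::idom \<Rightarrow> 'a \<Rightarrow> 'a \<Rightarrow> nat \<Rightarrow> (nat \<Rightarrow> nat \<Rightarrow> 'a) \<Rightarrow> nat \<Rightarrow> nat \<Rightarrow> 'a" where
  "coeffD g t k l p n i =
     (of_nat n + 1) * (of_nat n + g + k + 2 * of_nat i) * p (Suc n) i
   + (of_nat n + 1) * of_nat i * p (Suc n) (i - 1)
   - (of_nat n * (of_nat n + of_nat l + k + t + of_nat i) + of_nat i * (t + of_nat i)) * p n i
   + (of_nat l - of_nat i) * (of_nat i + g) * p n (Suc i)"

text \<open>
On coefficients, the operator \<open>E\<close>. Its second-order part is \<open>(1 - u)(R + u S) d\<^sup>2/du\<^sup>2\<close>, where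
\<open>R\<close> has the entries \<open>i\<close> at \<open>(i, i - 1)\<close> and \<open>S\<close> the entries \<open>i\<close> at \<open>(i, i)\<close>; its part of order
zero is \<open>- (l + k) V\<close>.
\<close>

definition coeffE :: "'a::idom \<Rightarrow> 'a \<Rightarrow> 'a \<Rightarrow> nat \<Rightarrow> (nat \<Rightarrow> nat \<Rightarrow> 'a) \<Rightarrow> nat \<Rightarrow> nat \<Rightarrow> 'a" where
  "coeffE g t k l p n i =
     (of_nat n + 1) * (of_nat n + 2) * of_nat i * p (Suc (Suc n)) (i - 1)
   + (of_nat n + 1) * (of_nat n * of_nat i + of_nat l * g
       + of_nat i * (2 * of_nat l + k - g + 1 - of_nat i)) * p (Suc n) i
   - (of_nat n + 1) * of_nat i * (of_nat n + of_nat i + t) * p (Suc n) (i - 1)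
   - of_nat i * (of_nat n + of_nat l + k) * (of_nat n + t + of_nat i) * p n i
   + (of_nat l - of_nat i) * (of_nat i + g) * (of_nat n + of_nat l + k) * p n (Suc i)"

text \<open>
A polynomial identity between the coefficients of the shifted entries. The cases \<open>i = 0\<close> and \<open>i = 1\<close>
are separate because the second index is lowered at most twice, with truncation.
\<close>

lemma coeffE_coeffD_commute: "coeffE g t k l (coeffD g t k l p) = coeffD g t k l (coeffE g t k l p)"
proof (intro ext)
  fix n i
  consider "i = 0" | "i = Suc 0" | i' where "i = Suc (Suc i')" by (metis not0_implies_Suc)
  then show "coeffE g t k l (coeffD g t k l p) n i = coeffD g t k l (coeffE g t k l p) n i"
  proof cases
    case 1
    show ?thesis
      unfolding 1 coeffD_def coeffE_def of_nat_Suc of_nat_0 diff_Suc_1 by algebra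
  next
    case 2
    show ?thesis
      unfolding 2 coeffD_def coeffE_def of_nat_Suc of_nat_0 diff_Suc_1 by algebra
  next
    case 3
    show ?thesis
      unfolding 3 coeffD_def coeffE_def of_nat_Suc diff_Suc_1 by algebra
  qed
qed

definition diagD :: "'a::idom \<Rightarrow> 'a \<Rightarrow> nat \<Rightarrow> nat \<Rightarrow> nat \<Rightarrow> 'a" where
  "diagD t k l n i =
     - (of_nat n * (of_nat n + of_nat l + k + t + of_nat i) + of_nat i * (t + of_nat i))"

definition diagE :: "'a::idom \<Rightarrow> 'a \<Rightarrow> nat \<Rightarrow> nat \<Rightarrow> nat \<Rightarrow> 'a" where
  "diagE t k l n i = - (of_nat i * (of_nat n + of_nat l + k) * (of_nat n + t + of_nat i))"

lemma vanish_from_later_entries: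
  assumes p: "vanish_from l (Suc (n * Suc l + i)) p" and i: "i \<le> l" and l: "l \<ge> 1"
  shows "p (Suc n) i = 0" "i \<noteq> 0 \<Longrightarrow> p (Suc n) (i - 1) = 0"
    "i \<noteq> 0 \<Longrightarrow> p (Suc (Suc n)) (i - 1) = 0" "i \<noteq> l \<Longrightarrow> p n (Suc i) = 0"
  using p i l unfolding vanish_from_def by (auto simp: algebra_simps)

lemma triangular_op_coeffD:
  assumes "l \<ge> 1"
  shows "triangular_op l (coeffD (g::'a::idom) t k l) (diagD t k l)"
  unfolding triangular_op_def
proof (intro conjI allI impI)
  fix p :: "nat \<Rightarrow> nat \<Rightarrow> 'a" and n i assume "i \<le> l" "vanish_from l (Suc (n * Suc l + i)) p"
  note v = vanish_from_later_entries[OF this(2,1) assms]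
  show "coeffD g t k l p n i = diagD t k l n i * p n i"
    using v by (cases "i = 0"; cases "i = l") (simp_all add: coeffD_def diagD_def algebra_simps)
qed (simp add: coeffD_def algebra_simps)

lemma triangular_op_coeffE:
  assumes "l \<ge> 1"
  shows "triangular_op l (coeffE (g::'a::idom) t k l) (diagE t k l)"
  unfolding triangular_op_def
proof (intro conjI allI impI)
  fix p :: "nat \<Rightarrow> nat \<Rightarrow> 'a" and n i assume "i \<le> l" "vanish_from l (Suc (n * Suc l + i)) p"
  note v = vanish_from_later_entries[OF this(2,1) assms]
  show "coeffE g t k l p n i = diagE t k l n i * p n i"
    using v by (cases "i = 0"; cases "i = l") (simp_all add: coeffE_def diagE_def algebra_simps)
qed (simp add: coeffE_def algebra_simps)

section \<open>Separation of the joint diagonal entries\<close>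

lemma diagD_same_degree_inj:
  fixes t k :: real
  assumes t: "t > -1" and eq: "diagD t k l n i = diagD t k l n j"
  shows "i = j"
proof (rule ccontr)
  assume ne: "i \<noteq> j"
  have "(real i - real j) * (real n + t + real i + real j) = 0"
    using eq by (simp add: diagD_def algebra_simps)
  moreover have "real i + real j \<ge> 1" using ne by linarith
  ultimately show False using t ne by auto
qed

text \<open>
Both diagonal entries together determine the monic cubic polynomial with roots \<open>j\<close>, \<open>w + l + k\<close> and
\<open>- (w + j + t)\<close>, of which \<open>i\<close> must be a root. It is not the second one, since \<open>i \<le> l < l + k\<close>, and
it is the third one only if \<open>i = w = j = 0\<close>, since \<open>t > -1\<close>. So \<open>i = j\<close>, and the first
diagonal entry is strictly monotonic in the degree.
\<close>

lemma diagD_diagE_inj: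
  fixes t k :: real
  assumes t: "t > -1" and k: "k > 0" and l: "l \<ge> 1" and i: "i \<le> l"
    and D: "diagD t k l n i = diagD t k l w j" and E: "diagE t k l n i = diagE t k l w j"
  shows "n = w \<and> i = j"
proof -
  have "(real i - real j) * (real i - (real w + real l + k)) * (real i + real w + t + real j) = 0"
    using D E unfolding diagD_def diagE_def by algebra
  moreover have "real i < real w + real l + k" using i k by linarith
  ultimately have "i = j \<or> real i + real w + t + real j = 0" by auto
  then have ij: "i = j"
    using t by linarith
  have "(real n - real w) * (real n + real w + real l + k + t + real j) = 0"
    using D unfolding diagD_def ij by algebra
  moreover have "real n + real w + real l + k + t + real j > 0" using t k l by linarith
  ultimately show ?thesis using ij by auto
qed

section \<open>The differential operator on coefficients\<close>

lemma sum_matE: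
  assumes "finite A"
  shows "(\<Sum>i\<in>A. c i * matE i (f i) r s) = (if r \<in> A \<and> s = f r then c r else 0)"
proof -
  have "(\<Sum>i\<in>A. c i * matE i (f i) r s) = (\<Sum>i\<in>A. if i = r then (if s = f r then c r else 0) else 0)"
    by (rule sum.cong) (auto simp: matE_def)
  then show ?thesis using assms by simp
qed

lemma sum_smult_single:
  "(\<Sum>s\<le>l. smult (complex_of_real (if b \<and> s = q then x else 0)) (P s))
     = (if b \<and> q \<le> l then smult (complex_of_real x) (P q) else 0)" for l q :: nat
proof -
  have "(\<Sum>s\<le>l. smult (complex_of_real (if b \<and> s = q then x else 0)) (P s))
      = (\<Sum>s\<le>l. if s = q then (if b then smult (complex_of_real x) (P q) else 0) else 0)"
    by (rule sum.cong) auto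
  then show ?thesis by simp
qed

lemma matvec_matC:
  assumes "r \<le> l"
  shows "matvec l (matC \<beta> l) P r
    = smult (complex_of_real (\<beta> + 1 + 2 * real r)) (P r) + smult (of_nat r) (P (r - 1))"
proof -
  have *: "matC \<beta> l r s = (if True \<and> s = r then \<beta> + 1 + 2 * real r else 0)
      + (if r \<in> {1..l} \<and> s = r - 1 then real r else 0)" for s
    using assms unfolding matC_def sum_matE[OF finite_atMost] sum_matE[OF finite_atLeastAtMost] by simp
  show ?thesis
    unfolding matvec_def * of_real_add smult_add_left sum.distrib sum_smult_single
    using assms by (cases "r = 0") auto
qed

lemma matvec_matU:
  assumes "r \<le> l"
  shows "matvec l (matU \<alpha> \<beta> l) P r
    = smult (complex_of_real (\<alpha> + \<beta> + real l + real r + 2)) (P r)"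
proof -
  have *: "matU \<alpha> \<beta> l r s = (if True \<and> s = r then \<alpha> + \<beta> + real l + real r + 2 else 0)" for s
    using assms unfolding matU_def sum_matE[OF finite_atMost] by simp
  show ?thesis
    unfolding matvec_def * sum_smult_single using assms by auto
qed

lemma matvec_matV:
  assumes "r \<le> l"
  shows "matvec l (matV \<alpha> \<beta> k l) P r
    = smult (complex_of_real (real r * (\<alpha> + \<beta> + real r - k + 1))) (P r)
    - smult (complex_of_real ((real l - real r) * (real r + \<beta> - k + 1))) (P (Suc r))"
proof -
  have *: "matV \<alpha> \<beta> k l r s = (if True \<and> s = r then real r * (\<alpha> + \<beta> + real r - k + 1) else 0)
      - (if r \<in> {..<l} \<and> s = r + 1 then (real l - real r) * (real r + \<beta> - k + 1) else 0)" for s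
    using assms unfolding matV_def sum_matE[OF finite_atMost] sum_matE[OF finite_lessThan] by simp
  show ?thesis
    unfolding matvec_def * of_real_diff smult_diff_left sum_subtractf sum_smult_single
    using assms by (cases "r = l") auto
qed

lemma coeff_opD:
  assumes "r \<le> l"
  shows "coeff (opD \<alpha> \<beta> k l P r) n
    = coeffD (complex_of_real (\<beta> - k + 1)) (complex_of_real (\<alpha> + \<beta> - k + 1)) (complex_of_real k) l
        (\<lambda>n i. coeff (P i) n) n r"
proof -
  have u: "[:0, 1:] * q = pCons 0 q" for q :: "complex poly" by simp
  have uu: "[:0, 1:] * (1 - [:0, 1:]) * q = pCons 0 q - pCons 0 (pCons 0 q)" for q :: "complex poly"
    by (simp add: algebra_simps)
  consider "n = 0" | "n = Suc 0" | m where "n = Suc (Suc m)" by (metis not0_implies_Suc)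
  then show ?thesis
    unfolding opD_def Let_def matvec_matC[OF assms] matvec_matU[OF assms] matvec_matV[OF assms]
      u uu coeffD_def
    by cases (simp_all add: coeff_pderiv algebra_simps)
qed

lemma opD_outside: "P \<in> vpolys l \<Longrightarrow> l < r \<Longrightarrow> opD \<alpha> \<beta> k l P r = 0"
  unfolding opD_def Let_def matvec_def matC_def matU_def matV_def
  by (simp add: sum_matE vpolys_def)

text \<open>
Above \<open>l\<close> both sides of \<open>D P = c P\<close> vanish, so only the components up to \<open>l\<close> give conditions.
\<close>

lemma mem_eigspace_iff:
  assumes "P \<in> vpolys l"
  shows "P \<in> eigspace \<alpha> \<beta> k l c \<longleftrightarrow>
    (\<forall>n. \<forall>i\<le>l. coeffD (complex_of_real (\<beta> - k + 1)) (complex_of_real (\<alpha> + \<beta> - k + 1)) (complex_of_real k) l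
        (\<lambda>n i. coeff (P i) n) n i = c * coeff (P i) n)"
proof -
  have "opD \<alpha> \<beta> k l P = vscale c P \<longleftrightarrow> (\<forall>n. \<forall>i\<le>l. coeff (opD \<alpha> \<beta> k l P i) n = c * coeff (P i) n)"
    (is "_ \<longleftrightarrow> ?R")
  proof
    assume R: ?R
    show "opD \<alpha> \<beta> k l P = vscale c P"
    proof (rule ext)
      fix i show "opD \<alpha> \<beta> k l P i = vscale c P i"
        using R opD_outside[OF assms] assms
        by (cases "i \<le> l") (auto simp: vscale_def poly_eq_iff vpolys_def)
    qed
  qed (simp add: vscale_def)
  then show ?thesis using assms by (simp add: eigspace_def coeff_opD)
qed

lemma diagD_eq_eigval:
  "diagD (complex_of_real (\<alpha> + \<beta> - k + 1)) (complex_of_real k) l n i = complex_of_real (eigval \<alpha> \<beta> k l i n)"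
  by (simp add: diagD_def eigval_def algebra_simps)

lemma diagE_of_real:
  "diagE (complex_of_real t) (complex_of_real k) l n i = complex_of_real (diagE t k l n i)"
  by (simp add: diagE_def)

lemma eigval_eq_diagD: "eigval \<alpha> \<beta> k l i n = diagD (\<alpha> + \<beta> - k + 1) k l n i"
  by (simp add: diagD_def eigval_def algebra_simps)

section \<open>Solutions with a prescribed last nonzero entry\<close>

lemma eigspace_leading_position:
  assumes P: "P \<in> eigspace \<alpha> \<beta> k l (complex_of_real lam)" and l: "l \<ge> 1" and i: "i \<le> l"
    and v: "vanish_from l (Suc (n * Suc l + i)) (\<lambda>n i. coeff (P i) n)"
    and ne: "coeff (P i) n \<noteq> 0"
  shows "lam = eigval \<alpha> \<beta> k l i n"
proof -
  have Pl: "P \<in> vpolys l" using P by (simp add: eigspace_def)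
  have "complex_of_real lam * coeff (P i) n = complex_of_real (eigval \<alpha> \<beta> k l i n) * coeff (P i) n"
    using triangular_op_diagonal[OF triangular_op_coeffD[OF l] v i order_refl]
      P[unfolded mem_eigspace_iff[OF Pl]] i
    by (metis diagD_eq_eigval)
  then show ?thesis using ne by simp
qed

lemma eigspace_leading_exists:
  assumes "\<alpha> > -1" "0 < k" "k < \<beta> + 1" and l: "l \<ge> 1" and j: "j \<le> l"
  shows "\<exists>P \<in> eigspace \<alpha> \<beta> k l (complex_of_real (eigval \<alpha> \<beta> k l j w)).
    vanish_from l (Suc (w * Suc l + j)) (\<lambda>n i. coeff (P i) n) \<and> coeff (P j) w \<noteq> 0"
proof -
  let ?g = "complex_of_real (\<beta> - k + 1)" and ?t = "complex_of_real (\<alpha> + \<beta> - k + 1)"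
    and ?k = "complex_of_real k"
  have sep: "n = w \<and> i = j"
    if "i \<le> l" "diagD ?t ?k l n i = diagD ?t ?k l w j" "diagE ?t ?k l n i = diagE ?t ?k l w j" for n i
  proof (rule diagD_diagE_inj)
    show "diagD (\<alpha> + \<beta> - k + 1) k l n i = diagD (\<alpha> + \<beta> - k + 1) k l w j"
      using that(2) by (simp only: diagD_eq_eigval eigval_eq_diagD of_real_eq_iff)
    show "diagE (\<alpha> + \<beta> - k + 1) k l n i = diagE (\<alpha> + \<beta> - k + 1) k l w j"
      using that(3) by (simp only: diagE_of_real of_real_eq_iff)
  qed (use assms that(1) in auto)
  have "\<exists>p. vanish_from l (Suc (w * Suc l + j)) p \<and> p w j \<noteq> 0 \<and>
      (\<forall>n. \<forall>i\<le>l. coeffD ?g ?t ?k l p n i = diagD ?t ?k l w j * p n i)"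
  proof (rule triangular_op_eigenvector[where T = "coeffD ?g ?t ?k l" and d = "diagD ?t ?k l"
        and S = "coeffE ?g ?t ?k l" and e = "diagE ?t ?k l"])
    show "triangular_op l (coeffD ?g ?t ?k l) (diagD ?t ?k l)" by (rule triangular_op_coeffD[OF l])
    show "triangular_op l (coeffE ?g ?t ?k l) (diagE ?t ?k l)" by (rule triangular_op_coeffE[OF l])
    show "coeffE ?g ?t ?k l (coeffD ?g ?t ?k l p) = coeffD ?g ?t ?k l (coeffE ?g ?t ?k l p)" for p
      by (rule coeffE_coeffD_commute)
  qed (use sep j in blast)+
  then obtain p where p: "vanish_from l (Suc (w * Suc l + j)) p" "p w j \<noteq> 0"
    and eig: "\<And>n i. i \<le> l \<Longrightarrow> coeffD ?g ?t ?k l p n i = diagD ?t ?k l w j * p n i"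
    by blast
  \<comment> \<open>The entries of \<open>p\<close> with second index above \<open>l\<close> are arbitrary, so they are cut off.\<close>
  define q where "q = (\<lambda>n i. if i \<le> l then p n i else 0)"
  define P where "P = (\<lambda>i. \<Sum>n\<le>w. monom (q n i) n)"
  have zero: "q n i = 0" if "n > w" for n i
  proof -
    have "n * Suc l \<ge> Suc w * Suc l" using that by (intro mult_le_mono1) simp
    then have "Suc (w * Suc l + j) \<le> n * Suc l + i" using j by simp
    then show ?thesis using p unfolding q_def vanish_from_def by auto
  qed
  have coeff_P: "coeff (P i) n = q n i" for n i
    using zero[of n i] by (auto simp: P_def coeff_sum)
  have Pl: "P \<in> vpolys l" by (auto simp: vpolys_def P_def q_def)
  have "coeffD ?g ?t ?k l q n i = diagD ?t ?k l w j * q n i" if i: "i \<le> l" for n i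
  proof -
    have "coeffD ?g ?t ?k l q n i = coeffD ?g ?t ?k l p n i"
      using i by (cases "i = l") (auto simp: coeffD_def q_def)
    then show ?thesis using eig[OF i] i by (simp add: q_def)
  qed
  then have "P \<in> eigspace \<alpha> \<beta> k l (complex_of_real (eigval \<alpha> \<beta> k l j w))"
    unfolding mem_eigspace_iff[OF Pl] coeff_P diagD_eq_eigval[symmetric] by blast
  moreover have "vanish_from l (Suc (w * Suc l + j)) (\<lambda>n i. coeff (P i) n)"
    using p(1) by (simp add: coeff_P q_def vanish_from_def)
  moreover have "coeff (P j) w \<noteq> 0" using p(2) j by (simp add: coeff_P q_def)
  ultimately show ?thesis by blast
qed

section \<open>Dimensions of the solution spaces\<close>

lemma vanish_from_Suc:
  assumes "i \<le> l"
  shows "vanish_from l (n * Suc l + i) p \<longleftrightarrow> vanish_from l (Suc (n * Suc l + i)) p \<and> p n i = 0"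
proof
  assume R: "vanish_from l (Suc (n * Suc l + i)) p \<and> p n i = 0"
  show "vanish_from l (n * Suc l + i) p"
    unfolding vanish_from_def
  proof (intro allI impI)
    fix a b assume b: "b \<le> l" and "n * Suc l + i \<le> a * Suc l + b"
    then consider "n * Suc l + i = a * Suc l + b" | "Suc (n * Suc l + i) \<le> a * Suc l + b"
      by linarith
    then show "p a b = 0"
      using R b position_eq_iff[OF assms b] by cases (auto simp: vanish_from_def)
  qed
qed (use assms in \<open>auto simp: vanish_from_def\<close>)

text \<open>
Passing from \<open>N\<close> to \<open>N + 1\<close> admits one more entry \<open>(n, i)\<close>. If \<open>lam\<close> is not the diagonal
entry there, this entry is zero in every solution; otherwise it is the last
nonzero entry of some solution \<open>F\<close>, and subtracting a multiple of \<open>F\<close> leads back to \<open>N\<close>. So the dimension grows by \<open>0\<close> or \<open>1\<close>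
accordingly.
\<close>

lemma basis_eigspace_vanish_from:
  fixes lam :: real
  assumes par: "\<alpha> > -1" "0 < k" "k < \<beta> + 1" and l: "l \<ge> 1"
  defines "H \<equiv> \<lambda>N. {P \<in> eigspace \<alpha> \<beta> k l (complex_of_real lam). vanish_from l N (\<lambda>n i. coeff (P i) n)}"
  shows "\<exists>B. B \<subseteq> H N \<and> finite B \<and> vpoly.independent B \<and> H N \<subseteq> vpoly.span B \<and>
    card B = card {(n, i). i \<le> l \<and> n * Suc l + i < N \<and> lam = eigval \<alpha> \<beta> k l i n}"
proof (induction N)
  case 0
  have "H 0 \<subseteq> {0}"
    by (auto simp: H_def vanish_from_def eigspace_def vpolys_def fun_eq_iff poly_eq_iff)
      (metis coeff_0 not_le)
  then show ?case by (intro exI[of _ "{}"]) (auto simp: vpoly.span_empty vpoly.independent_empty)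
next
  case (Suc N)
  obtain n i where i: "i \<le> l" and N: "N = n * Suc l + i" using position_exists by blast
  obtain B where B: "B \<subseteq> H N" "finite B" "vpoly.independent B" "H N \<subseteq> vpoly.span B"
    and card: "card B = card {(n, i). i \<le> l \<and> n * Suc l + i < N \<and> lam = eigval \<alpha> \<beta> k l i n}"
    (is "_ = card ?I") using Suc by blast
  let ?J = "{(n, i). i \<le> l \<and> n * Suc l + i < Suc N \<and> lam = eigval \<alpha> \<beta> k l i n}"
  have fin: "finite ?I" by (rule finite_subset[OF _ finite_eigval_eq[of l lam \<alpha> \<beta> k]]) auto
  have H_Suc: "P \<in> H N \<longleftrightarrow> P \<in> H (Suc N) \<and> coeff (P i) n = 0" for P
    using vanish_from_Suc[OF i, of n "\<lambda>n i. coeff (P i) n"] unfolding H_def N by blast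
  have J: "?J = (if lam = eigval \<alpha> \<beta> k l i n then insert (n, i) ?I else ?I)"
    using i position_eq_iff[OF _ i] by (auto simp: less_Suc_eq N simp del: mult_Suc_right)
  show ?case
  proof (cases "lam = eigval \<alpha> \<beta> k l i n")
    case False
    then have "P \<in> H (Suc N) \<Longrightarrow> coeff (P i) n = 0" for P
      using eigspace_leading_position[OF _ l i] unfolding H_def N by blast
    then have "H (Suc N) = H N" using H_Suc by blast
    then show ?thesis using B card J False by auto
  next
    case True
    then obtain F where F: "F \<in> H (Suc N)" and F0: "coeff (F i) n \<noteq> 0"
      using eigspace_leading_exists[OF par l i, of n] unfolding H_def N by blast
    have "vpoly.subspace {P :: vpoly. coeff (P i) n = 0}"
      by (auto simp: vpoly.subspace_def vscale_def)
    then have "vpoly.span B \<subseteq> {P. coeff (P i) n = 0}"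
      using B(1) H_Suc by (intro vpoly.span_minimal) auto
    then have notin: "F \<notin> vpoly.span B" using F0 by auto
    then have "F \<notin> B" using vpoly.span_base by blast
    moreover have "(n, i) \<notin> ?I" by (simp add: N)
    ultimately have "card (insert F B) = card ?J"
      using J True fin B(2) card by simp
    moreover have "vpoly.independent (insert F B)"
      by (rule vpoly.independent_insertI[OF notin B(3)])
    moreover have "insert F B \<subseteq> H (Suc N)" using F B(1) H_Suc by auto
    moreover have "H (Suc N) \<subseteq> vpoly.span (insert F B)"
    proof
      fix P assume P: "P \<in> H (Suc N)"
      define c where "c = coeff (P i) n / coeff (F i) n"
      have "P - vscale c F \<in> eigspace \<alpha> \<beta> k l (complex_of_real lam)"
        using P F unfolding H_def
        by (auto intro: vpoly.subspace_diff vpoly.subspace_scale subspace_eigspace)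
      moreover have "vanish_from l (Suc N) (\<lambda>n i. coeff ((P - vscale c F) i) n)"
        using P F by (auto simp: H_def vanish_from_def vscale_def)
      moreover have "coeff ((P - vscale c F) i) n = 0"
        using F0 by (simp add: c_def vscale_def)
      ultimately have "P - vscale c F \<in> H N" unfolding H_Suc by (simp add: H_def)
      then have "P - vscale c F \<in> vpoly.span B" using B(4) by blast
      then show "P \<in> vpoly.span (insert F B)" using vpoly.span_insert by blast
    qed
    ultimately show ?thesis using B(2) by blast
  qed
qed

lemma dim_eigspace_vanish_from:
  assumes "\<alpha> > -1" "0 < k" "k < \<beta> + 1" "l \<ge> 1"
  shows "vpoly.dim {P \<in> eigspace \<alpha> \<beta> k l (complex_of_real lam). vanish_from l N (\<lambda>n i. coeff (P i) n)}
    = card {(n, i). i \<le> l \<and> n * Suc l + i < N \<and> lam = eigval \<alpha> \<beta> k l i n}"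
proof -
  obtain B where "B \<subseteq> {P \<in> eigspace \<alpha> \<beta> k l (complex_of_real lam). vanish_from l N (\<lambda>n i. coeff (P i) n)}"
    and "{P \<in> eigspace \<alpha> \<beta> k l (complex_of_real lam). vanish_from l N (\<lambda>n i. coeff (P i) n)}
      \<subseteq> vpoly.span B"
    and "vpoly.independent B"
    and card: "card B = card {(n, i). i \<le> l \<and> n * Suc l + i < N \<and> lam = eigval \<alpha> \<beta> k l i n}"
    using basis_eigspace_vanish_from[OF assms, of lam N] by blast
  from vpoly.basis_card_eq_dim[OF this(1-3)] card show ?thesis by simp
qed

lemma position_less_iff: "i \<le> l \<Longrightarrow> n * Suc l + i < Suc w * Suc l \<longleftrightarrow> n \<le> w" for i l n w :: nat
  using div_less_iff_less_mult[of "Suc l" "n * Suc l + i" "Suc w"]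
  by (simp add: position_div less_Suc_eq_le del: mult_Suc mult_Suc_right)

lemma vdegree_le_iff_vanish_from:
  "vdegree l P \<le> w \<longleftrightarrow> vanish_from l (Suc w * Suc l) (\<lambda>n i. coeff (P i) n)"
proof -
  have "degree p \<le> w \<longleftrightarrow> (\<forall>n>w. coeff p n = 0)" for p :: "complex poly"
    by (intro iffI allI impI degree_le) (auto intro: coeff_eq_0)
  moreover have "Suc w * Suc l \<le> n * Suc l + i \<longleftrightarrow> w < n" if "i \<le> l" for n i
    using position_less_iff[OF that, of n w] by linarith
  ultimately show ?thesis
    unfolding vdegree_le_iff vanish_from_def by auto
qed

lemma dim_eigspace_degree:
  assumes "\<alpha> > -1" "0 < k" "k < \<beta> + 1" "l \<ge> 1"
  shows "vpoly.dim {P \<in> eigspace \<alpha> \<beta> k l (complex_of_real lam). vdegree l P \<le> w}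
    = card {(n, i). i \<le> l \<and> n \<le> w \<and> lam = eigval \<alpha> \<beta> k l i n}"
proof -
  have "{(n, i). i \<le> l \<and> n * Suc l + i < Suc w * Suc l \<and> lam = eigval \<alpha> \<beta> k l i n}
      = {(n, i). i \<le> l \<and> n \<le> w \<and> lam = eigval \<alpha> \<beta> k l i n}"
    using position_less_iff[of _ l _ w] by blast
  then show ?thesis
    unfolding vdegree_le_iff_vanish_from dim_eigspace_vanish_from[OF assms] by simp
qed

text \<open>
The last nonzero entry of a solution sits at one of the counted pairs, so their degrees bound it.
\<close>

lemma eigspace_degree_bound:
  assumes P: "P \<in> eigspace \<alpha> \<beta> k l (complex_of_real lam)" and l: "l \<ge> 1"
    and W: "\<And>n i. i \<le> l \<Longrightarrow> lam = eigval \<alpha> \<beta> k l i n \<Longrightarrow> n \<le> W"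
  shows "vdegree l P \<le> W"
proof -
  define M where "M = Suc (W + vdegree l P) * Suc l"
  have start: "Suc W * Suc l \<le> M" unfolding M_def by (intro mult_le_mono1) simp
  have top: "vanish_from l M (\<lambda>n i. coeff (P i) n)"
    using vdegree_le_iff_vanish_from[of l P "W + vdegree l P"] by (simp only: M_def le_add2)
  from start have "vanish_from l (Suc W * Suc l) (\<lambda>n i. coeff (P i) n)"
  proof (induction rule: inc_induct)
    case base
    show ?case by (rule top)
  next
    case (step N)
    note N = step.hyps(1) and v = step.IH
    obtain n i where i: "i \<le> l" and Nni: "N = n * Suc l + i" using position_exists by blast
    have "\<not> n \<le> W" using position_less_iff[OF i, of n W] N Nni by simp
    then have "coeff (P i) n = 0"
      using eigspace_leading_position[OF P l i v[unfolded Nni]] W[OF i] by blast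
    then show "vanish_from l N (\<lambda>n i. coeff (P i) n)"
      unfolding Nni vanish_from_Suc[OF i] using v Nni by simp
  qed
  then show ?thesis unfolding vdegree_le_iff_vanish_from .
qed

theorem proposition2p3:
  fixes \<alpha> \<beta> k lam :: real and l w j :: nat
  assumes "\<alpha> > -1" and "\<beta> > -1" and "0 < k" and "k < \<beta> + 1"
    and "l \<ge> 1" and "j \<le> l" and "lam = eigval \<alpha> \<beta> k l j w"
  shows "vpoly.dim {P \<in> eigspace \<alpha> \<beta> k l (complex_of_real lam). vdegree l P \<le> w}
           = card {w'. w' \<le> w \<and> (\<exists>j'\<le>l. lam = eigval \<alpha> \<beta> k l j' w')} \<and>
         vpoly.dim (eigspace \<alpha> \<beta> k l (complex_of_real lam))
           = card {(w', j'). j' \<le> l \<and> lam = eigval \<alpha> \<beta> k l j' w'}"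
proof
  note par = assms(1,3,4,5)
  let ?I = "{(w', j'). j' \<le> l \<and> w' \<le> w \<and> lam = eigval \<alpha> \<beta> k l j' w'}"
  have "inj_on fst ?I"
  proof (rule inj_onI, clarsimp)
    fix n i i' assume "eigval \<alpha> \<beta> k l i n = eigval \<alpha> \<beta> k l i' n"
    then show "i = i'"
      using diagD_same_degree_inj[of "\<alpha> + \<beta> - k + 1"] par unfolding eigval_eq_diagD by simp
  qed
  then have "card (fst ` ?I) = card ?I" by (rule card_image)
  moreover have "fst ` ?I = {w'. w' \<le> w \<and> (\<exists>j'\<le>l. lam = eigval \<alpha> \<beta> k l j' w')}"
    by force
  ultimately show "vpoly.dim {P \<in> eigspace \<alpha> \<beta> k l (complex_of_real lam). vdegree l P \<le> w}
      = card {w'. w' \<le> w \<and> (\<exists>j'\<le>l. lam = eigval \<alpha> \<beta> k l j' w')}"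
    unfolding dim_eigspace_degree[OF par] by simp
next
  note par = assms(1,3,4,5)
  let ?J = "{(w', j'). j' \<le> l \<and> lam = eigval \<alpha> \<beta> k l j' w'}"
  have "finite (fst ` ?J)" by (rule finite_imageI[OF finite_eigval_eq])
  then obtain W where "\<forall>n \<in> fst ` ?J. n \<le> W"
    unfolding finite_nat_set_iff_bounded_le by blast
  then have W: "n \<le> W" if "i \<le> l" "lam = eigval \<alpha> \<beta> k l i n" for n i
  proof -
    have "n \<in> fst ` ?J" using that by (intro image_eqI[of _ fst "(n, i)"]) simp_all
    with \<open>\<forall>n \<in> fst ` ?J. n \<le> W\<close> show ?thesis by blast
  qed
  have "vdegree l P \<le> W" if "P \<in> eigspace \<alpha> \<beta> k l (complex_of_real lam)" for P
    by (rule eigspace_degree_bound[OF that par(4) W])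
  then have "{P \<in> eigspace \<alpha> \<beta> k l (complex_of_real lam). vdegree l P \<le> W}
      = eigspace \<alpha> \<beta> k l (complex_of_real lam)"
    by blast
  moreover have "{(n, i). i \<le> l \<and> n \<le> W \<and> lam = eigval \<alpha> \<beta> k l i n} = ?J" using W by blast
  ultimately show "vpoly.dim (eigspace \<alpha> \<beta> k l (complex_of_real lam)) = card ?J"
    using dim_eigspace_degree[OF par, of lam W] by simp
qed

end
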